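(* Let $G$ and $H$ be left-topological groups such that $G$ is locally compact, Lindelöf and pseudo-metrizable, and $H$ is a Hausdorff Baire space. If $f\colon G\rightarrow H$ is a continuous onto $G$-equivariant function, then $f$ is an open mapping.
   Context: A left-topological group is a group $G$ with a topology such that $L_g\colon G\to G$, $x\mapsto gx$, is continuous for every $g\in G$. A space is Lindelöf if every open cover has a countable subcover. A function $f\colon G\to H$ between groups is $G$-equivariant if there is a function $\tau\colon G\to H$ with $f(tx)=\tau(t)f(x)$ for all $t,x\in G$. *)

theory Defs
  imports "HOL-Analysis.Analysis" "HOL-Algebra.Group"
begin

text \<open>Only left translations are required to be continuous: neither joint continuity of the
  multiplication nor continuity of the inverse is assumed, and no separation axiom is built in.\<close>

locale left_topological_group = group G for G (structure) +
  fixes X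
  assumes topspace_eq_carrier: "topspace X = carrier G"
    and continuous_left_mult: "g \<in> carrier G \<Longrightarrow> continuous_map X X (\<lambda>x. g \<otimes> x)"

definition pseudometric_on :: "'a set \<Rightarrow> ('a \<Rightarrow> 'a \<Rightarrow> real) \<Rightarrow> bool" where
  "pseudometric_on M d \<longleftrightarrow>
     (\<forall>x\<in>M. \<forall>y\<in>M. 0 \<le> d x y) \<and>
     (\<forall>x\<in>M. d x x = 0) \<and>
     (\<forall>x\<in>M. \<forall>y\<in>M. d x y = d y x) \<and>
     (\<forall>x\<in>M. \<forall>y\<in>M. \<forall>z\<in>M. d x z \<le> d x y + d y z)"

text \<open>Unlike \<^const>\<open>metrizable_space\<close>, distinct points may have distance 0.\<close>

definition pseudometrizable_space :: "'a topology \<Rightarrow> bool" where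
  "pseudometrizable_space X \<longleftrightarrow>
     (\<exists>d. pseudometric_on (topspace X) d \<and>
        (\<forall>U. openin X U \<longleftrightarrow>
           U \<subseteq> topspace X \<and> (\<forall>x\<in>U. \<exists>r>0. {y \<in> topspace X. d x y < r} \<subseteq> U)))"

definition Baire_space :: "'a topology \<Rightarrow> bool" where
  "Baire_space X \<longleftrightarrow>
     (\<forall>\<D>. countable \<D> \<and> (\<forall>D\<in>\<D>. openin X D \<and> X closure_of D = topspace X)
        \<longrightarrow> X closure_of (\<Inter>\<D>) = topspace X)"

text \<open>The function \<open>\<tau>\<close> is arbitrary: it need be neither a homomorphism nor continuous.\<close>

definition equivariant_map :: "('a, 'm) monoid_scheme \<Rightarrow> ('b, 'n) monoid_scheme \<Rightarrow> ('a \<Rightarrow> 'b) \<Rightarrow> bool"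
  where
  "equivariant_map G H f \<longleftrightarrow>
     f \<in> carrier G \<rightarrow> carrier H \<and>
     (\<exists>\<tau> \<in> carrier G \<rightarrow> carrier H. \<forall>t\<in>carrier G. \<forall>x\<in>carrier G.
        f (t \<otimes>\<^bsub>G\<^esub> x) = \<tau> t \<otimes>\<^bsub>H\<^esub> f x)"

end

theory Submission
  imports Defs
begin

text \<open>
  Left translations of \<open>G\<close> and of \<open>H\<close> are homeomorphisms, and equivariance says that \<open>f\<close>
  intertwines the translation by \<open>t\<close> with the translation by \<open>\<tau> t\<close>. Hence openness at a single
  point of \<open>G\<close> spreads to every point, and only one good point has to be found.

  Baire category supplies it. Local compactness and the Lindelof property, applied at the scales
  \<open>1 / (n + 1)\<close> of a pseudometric, give a countable network of compact sets \<open>K\<close>: whenever \<open>x\<close>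
  lies in an open set \<open>U\<close>, some member satisfies \<open>x \<in> K \<subseteq> U\<close>
  (\<open>countable_compact_network\<close>). Each image \<open>f ` K\<close> is compact, hence closed in the Hausdorff
  space \<open>H\<close>, so that its frontier is nowhere dense. A point \<open>y = f a\<close> outside these countably many
  frontiers lies in the interior of every \<open>f ` K\<close> to which it belongs; as the sets \<open>K \<ni> a\<close>
  shrink into all neighbourhoods of \<open>a\<close>, the map is open at \<open>a\<close>
  (\<open>exists_point_of_openness\<close>).

  The usual proof for topological groups chooses \<open>V\<close> with \<open>V\<inverse> V \<subseteq> U\<close>, which would
  require joint continuity and continuous inversion; looking for a point outside the
  frontiers avoids both.
\<close>

text \<open>Regularity is what turns local compactness, which provides only one compact neighbourhood
  of each point, into arbitrarily small compact neighbourhoods. A point at distance at least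
  \<open>r\<close> from a closed set is separated from it at the threshold \<open>r / 2\<close>.\<close>

lemma pseudometrizable_imp_regular_space:
  assumes "pseudometrizable_space X"
  shows "regular_space X"
proof -
  obtain d where d: "pseudometric_on (topspace X) d"
    and op: "\<And>U. openin X U \<longleftrightarrow>
      U \<subseteq> topspace X \<and> (\<forall>x\<in>U. \<exists>r>0. {y \<in> topspace X. d x y < r} \<subseteq> U)"
    using assms unfolding pseudometrizable_space_def by blast
  have zero: "d x x = 0" if "x \<in> topspace X" for x
    using d that unfolding pseudometric_on_def by blast
  have sym: "d x y = d y x" if "x \<in> topspace X" "y \<in> topspace X" for x y
    using d that unfolding pseudometric_on_def by blast
  have tri: "d x z \<le> d x y + d y z"
    if "x \<in> topspace X" "y \<in> topspace X" "z \<in> topspace X" for x y z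
    using d that unfolding pseudometric_on_def by blast
  show ?thesis
    unfolding regular_space_def
  proof clarify
    fix C a
    assume C: "closedin X C" and a: "a \<in> topspace X" "a \<notin> C"
    have "openin X (topspace X - C)" using C by blast
    then obtain r where r: "r > 0" "{y \<in> topspace X. d a y < r} \<subseteq> topspace X - C"
      using a unfolding op by blast
    let ?U = "{y \<in> topspace X. d a y < r/2}" and ?V = "{y \<in> topspace X. d a y > r/2}"
    have "\<exists>e>0. {z \<in> topspace X. d y z < e} \<subseteq> ?U" if "y \<in> ?U" for y
      using that tri[OF a(1), of y] by (intro exI[of _ "r/2 - d a y"]) fastforce
    then have U: "openin X ?U"
      unfolding op by blast
    have "\<exists>e>0. {z \<in> topspace X. d y z < e} \<subseteq> ?V" if y: "y \<in> ?V" for y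
    proof (intro exI[of _ "d a y - r/2"] conjI subsetI)
      show "d a y - r/2 > 0" using y by simp
      fix z assume "z \<in> {z \<in> topspace X. d y z < d a y - r/2}"
      then show "z \<in> ?V" using y tri[OF a(1), of z y] sym[of y z] by auto
    qed
    then have V: "openin X ?V"
      unfolding op by blast
    have "C \<subseteq> ?V" using r C closedin_subset by fastforce
    moreover have "a \<in> ?U" using a zero r by simp
    moreover have "disjnt ?U ?V" by (auto simp: disjnt_def)
    ultimately show "\<exists>U V. openin X U \<and> openin X V \<and> a \<in> U \<and> C \<subseteq> V \<and> disjnt U V"
      using U V by blast
  qed
qed

text \<open>At each scale every point has a compact neighbourhood inside a small ball, and by the
  Lindelof property the interiors of countably many of these cover the space. If \<open>x\<close> lies in such a neighbourhood,
  chosen for a centre \<open>y\<close>, then the triangle inequality through \<open>y\<close> keeps the whole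
  neighbourhood within twice the scale of \<open>x\<close>.\<close>

lemma countable_compact_network:
  assumes lc: "locally_compact_space X" and Lin: "Lindelof_space X"
    and pm: "pseudometrizable_space X"
  obtains \<K> where "countable \<K>" "\<And>K. K \<in> \<K> \<Longrightarrow> compactin X K"
    "\<And>U x. openin X U \<Longrightarrow> x \<in> U \<Longrightarrow> \<exists>K\<in>\<K>. x \<in> K \<and> K \<subseteq> U"
proof -
  obtain d where d: "pseudometric_on (topspace X) d"
    and op: "\<And>U. openin X U \<longleftrightarrow>
      U \<subseteq> topspace X \<and> (\<forall>x\<in>U. \<exists>r>0. {y \<in> topspace X. d x y < r} \<subseteq> U)"
    using pm unfolding pseudometrizable_space_def by blast
  have zero: "d x x = 0" if "x \<in> topspace X" for x
    using d that unfolding pseudometric_on_def by blast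
  have sym: "d x y = d y x" if "x \<in> topspace X" "y \<in> topspace X" for x y
    using d that unfolding pseudometric_on_def by blast
  have tri: "d x z \<le> d x y + d y z"
    if "x \<in> topspace X" "y \<in> topspace X" "z \<in> topspace X" for x y z
    using d that unfolding pseudometric_on_def by blast
  have ball_open: "openin X {y \<in> topspace X. d x y < r}" if x: "x \<in> topspace X" for x r
  proof -
    have "\<exists>e>0. {z \<in> topspace X. d y z < e} \<subseteq> {y \<in> topspace X. d x y < r}"
      if "y \<in> topspace X" "d x y < r" for y
      using that tri[OF x, of y] by (intro exI[of _ "r - d x y"]) fastforce
    then show ?thesis unfolding op by blast
  qed
  have nb: "neighbourhood_base_of (compactin X) X"
    using lc pm locally_compact_imp_neighbourhood_base pseudometrizable_imp_regular_space by blast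
  have "\<exists>C. compactin X C \<and> x \<in> X interior_of C \<and>
          C \<subseteq> {y \<in> topspace X. d x y < inverse (real (Suc n))}"
    if x: "x \<in> topspace X" for x n
  proof -
    have "x \<in> {y \<in> topspace X. d x y < inverse (real (Suc n))}"
      using x zero by simp
    with ball_open[OF x] obtain V C where "openin X V" "compactin X C" "x \<in> V" "V \<subseteq> C"
        "C \<subseteq> {y \<in> topspace X. d x y < inverse (real (Suc n))}"
      using nb unfolding neighbourhood_base_of by meson
    then show ?thesis
      using interior_of_maximal[of V C X] by blast
  qed
  then have "\<forall>n. \<forall>x\<in>topspace X. \<exists>C. compactin X C \<and> x \<in> X interior_of C \<and>
          C \<subseteq> {y \<in> topspace X. d x y < inverse (real (Suc n))}"
    by blast
  then obtain C where C: "\<And>x n. x \<in> topspace X \<Longrightarrow>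
      compactin X (C n x) \<and> x \<in> X interior_of (C n x) \<and>
      C n x \<subseteq> {y \<in> topspace X. d x y < inverse (real (Suc n))}"
    unfolding bchoice_iff choice_iff by blast
  have "\<exists>S. countable S \<and> S \<subseteq> topspace X \<and> topspace X \<subseteq> (\<Union>x\<in>S. X interior_of (C n x))" for n
  proof -
    let ?\<U> = "(\<lambda>x. X interior_of (C n x)) ` topspace X"
    have "topspace X \<subseteq> \<Union>?\<U>" using C by blast
    then obtain \<V> where "countable \<V>" "\<V> \<subseteq> ?\<U>" "topspace X \<subseteq> \<Union>\<V>"
      using Lin[unfolded Lindelof_space_alt, rule_format, of ?\<U>] by auto
    then show ?thesis
      by (metis countable_subset_image)
  qed
  then obtain S where S: "\<And>n. countable (S n)" "\<And>n. S n \<subseteq> topspace X"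
      "\<And>n. topspace X \<subseteq> (\<Union>x\<in>S n. X interior_of (C n x))"
    by metis
  show ?thesis
  proof
    show "countable (\<Union>n. C n ` S n)" using S(1) by blast
    show "compactin X K" if "K \<in> (\<Union>n. C n ` S n)" for K
      using that S(2) C by blast
  next
    fix U x
    assume U: "openin X U" "x \<in> U"
    then have x: "x \<in> topspace X" using openin_subset by blast
    obtain r where r: "r > 0" "{y \<in> topspace X. d x y < r} \<subseteq> U"
      using U unfolding op by blast
    obtain n where n: "inverse (real (Suc n)) < r/2"
      using reals_Archimedean[of "r/2"] r by auto
    obtain y where y: "y \<in> S n" "x \<in> X interior_of (C n y)" using S(3)[of n] x by blast
    then have yX: "y \<in> topspace X" using S(2) by blast
    have xC: "x \<in> C n y" using y(2) interior_of_subset[of X "C n y"] by blast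
    moreover have "C n y \<subseteq> U"
    proof
      fix z assume "z \<in> C n y"
      then have "z \<in> topspace X" "d y z < r/2" "d y x < r/2"
        using C[OF yX, of n] xC n by force+
      then show "z \<in> U"
        using tri[OF x yX, of z] sym[OF x yX] r(2) by auto
    qed
    ultimately show "\<exists>K\<in>(\<Union>n. C n ` S n). x \<in> K \<and> K \<subseteq> U" using y(1) by blast
  qed
qed

text \<open>The interior of the frontier of a closed set \<open>S\<close> is an open subset of \<open>S\<close>, hence part of
  the interior of \<open>S\<close>, which the frontier excludes.\<close>

lemma dense_complement_frontier_of_closedin:
  assumes "closedin Y S"
  shows "Y closure_of (topspace Y - Y frontier_of S) = topspace Y"
proof -
  have sub: "Y interior_of (Y frontier_of S) \<subseteq> Y frontier_of S"
    by (rule interior_of_subset)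
  have "Y frontier_of S \<subseteq> S"
    using assms frontier_of_subset_closedin by blast
  then have "Y interior_of (Y frontier_of S) \<subseteq> Y interior_of S"
    by (rule interior_of_mono)
  then have "Y interior_of (Y frontier_of S) = {}"
    using sub unfolding frontier_of_def by blast
  then show ?thesis
    by (simp add: closure_of_complement)
qed

text \<open>The Baire property yields a point \<open>y\<close> outside the frontiers of all the closed sets
  \<open>f ` K\<close>, and any preimage \<open>a\<close> of \<open>y\<close> will do: once \<open>a \<in> K\<close>, the point \<open>y\<close> belongs to
  \<open>f ` K\<close> but not to its frontier, hence to its interior.\<close>

lemma exists_point_of_openness:
  assumes net: "countable \<K>" "\<And>K. K \<in> \<K> \<Longrightarrow> compactin X K"
      "\<And>U x. openin X U \<Longrightarrow> x \<in> U \<Longrightarrow> \<exists>K\<in>\<K>. x \<in> K \<and> K \<subseteq> U"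
    and Y: "Hausdorff_space Y" "Baire_space Y" "topspace Y \<noteq> {}"
    and f: "continuous_map X Y f" "f ` topspace X = topspace Y"
  obtains a where "a \<in> topspace X"
    "\<And>U. openin X U \<Longrightarrow> a \<in> U \<Longrightarrow> f a \<in> Y interior_of (f ` U)"
proof -
  have cl: "closedin Y (f ` K)" if "K \<in> \<K>" for K
    using that net(2) Y(1) f(1) image_compactin compactin_imp_closedin by metis
  define \<D> where "\<D> = (\<lambda>K. topspace Y - Y frontier_of (f ` K)) ` \<K>"
  have "countable \<D>" using net(1) by (simp add: \<D>_def)
  moreover have "\<forall>D\<in>\<D>. openin Y D \<and> Y closure_of D = topspace Y"
    unfolding \<D>_def
    using cl dense_complement_frontier_of_closedin closedin_frontier_of by blast
  ultimately have "Y closure_of (\<Inter>\<D>) = topspace Y"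
    using Y(2) unfolding Baire_space_def by blast
  then have "topspace Y \<inter> \<Inter>\<D> \<noteq> {}"
    using Y(3) by (metis closure_of_restrict closure_of_empty)
  then obtain y where y: "y \<in> topspace Y" "y \<in> \<Inter>\<D>" by blast
  obtain a where a: "a \<in> topspace X" "f a = y"
    using y(1) unfolding f(2)[symmetric] by blast
  show ?thesis
  proof
    fix U assume "openin X U" "a \<in> U"
    then obtain K where K: "K \<in> \<K>" "a \<in> K" "K \<subseteq> U" using net(3) by blast
    then have "f a \<notin> Y frontier_of (f ` K)" using a(2) y(2) unfolding \<D>_def by blast
    moreover have "f a \<in> Y closure_of (f ` K)"
      using K cl by (simp add: closure_of_closedin)
    ultimately have "f a \<in> Y interior_of (f ` K)" by (simp add: frontier_of_def)
    then show "f a \<in> Y interior_of (f ` U)"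
      by (meson K(3) image_mono interior_of_mono subsetD)
  qed (rule a(1))
qed

text \<open>The translate \<open>g \<otimes> U\<close> is the preimage of \<open>U\<close> under translation by \<open>inv g\<close>.\<close>

lemma (in left_topological_group) openin_left_translate:
  assumes g: "g \<in> carrier G" and U: "openin X U"
  shows "openin X ((\<lambda>x. g \<otimes> x) ` U)"
proof -
  have UG: "U \<subseteq> carrier G" using U openin_subset topspace_eq_carrier by blast
  have "(\<lambda>x. g \<otimes> x) ` U = {x \<in> topspace X. inv g \<otimes> x \<in> U}"
  proof (intro equalityI subsetI)
    fix x assume "x \<in> (\<lambda>x. g \<otimes> x) ` U"
    then show "x \<in> {x \<in> topspace X. inv g \<otimes> x \<in> U}"
      using g UG by (auto simp: topspace_eq_carrier m_assoc[symmetric])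
  next
    fix x assume x: "x \<in> {x \<in> topspace X. inv g \<otimes> x \<in> U}"
    then have "x = g \<otimes> (inv g \<otimes> x)"
      using g by (simp add: topspace_eq_carrier m_assoc[symmetric])
    then show "x \<in> (\<lambda>x. g \<otimes> x) ` U" using x by blast
  qed
  then show ?thesis
    using openin_continuous_map_preimage[OF continuous_left_mult U] g by simp
qed

theorem theorem1p4p4:
  fixes G :: "('a, 'm) monoid_scheme" and H :: "('b, 'n) monoid_scheme"
    and X :: "'a topology" and Y :: "'b topology" and f :: "'a \<Rightarrow> 'b"
  assumes "left_topological_group G X"
    and "left_topological_group H Y"
    and "locally_compact_space X"
    and "Lindelof_space X"
    and "pseudometrizable_space X"
    and "Hausdorff_space Y"
    and "Baire_space Y"
    and "continuous_map X Y f"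
    and "f ` carrier G = carrier H"
    and "equivariant_map G H f"
  shows "open_map X Y f"
proof -
  interpret G: left_topological_group G X by fact
  interpret H: left_topological_group H Y by fact
  obtain \<tau> where \<tau>: "\<And>t. t \<in> carrier G \<Longrightarrow> \<tau> t \<in> carrier H"
      "\<And>t x. t \<in> carrier G \<Longrightarrow> x \<in> carrier G \<Longrightarrow> f (t \<otimes>\<^bsub>G\<^esub> x) = \<tau> t \<otimes>\<^bsub>H\<^esub> f x"
    using assms(10) unfolding equivariant_map_def by blast
  obtain \<K> where \<K>: "countable \<K>" "\<And>K. K \<in> \<K> \<Longrightarrow> compactin X K"
      "\<And>U x. openin X U \<Longrightarrow> x \<in> U \<Longrightarrow> \<exists>K\<in>\<K>. x \<in> K \<and> K \<subseteq> U"
    using countable_compact_network[OF assms(3,4,5)] by blast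
  have ne: "topspace Y \<noteq> {}"
    using H.one_closed H.topspace_eq_carrier by blast
  have onto: "f ` topspace X = topspace Y"
    using assms(9) by (simp add: G.topspace_eq_carrier H.topspace_eq_carrier)
  obtain a where a: "a \<in> carrier G"
    and fa: "\<And>U. openin X U \<Longrightarrow> a \<in> U \<Longrightarrow> f a \<in> Y interior_of (f ` U)"
    using exists_point_of_openness[OF \<K> assms(6,7) ne assms(8) onto]
    by (auto simp: G.topspace_eq_carrier)
  show ?thesis
    unfolding open_map_def
  proof (intro allI impI)
    fix U assume U: "openin X U"
    then have UG: "U \<subseteq> carrier G" using openin_subset G.topspace_eq_carrier by blast
    have "\<exists>W. openin Y W \<and> f x \<in> W \<and> W \<subseteq> f ` U" if "x \<in> U" for x
    proof -
      have x: "x \<in> carrier G" using that UG by blast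
      \<comment> \<open>the translation by \<open>t\<close> carries the point of openness \<open>a\<close> to \<open>x\<close>\<close>
      define t where "t = x \<otimes>\<^bsub>G\<^esub> inv\<^bsub>G\<^esub> a"
      have t: "t \<in> carrier G" and ta: "t \<otimes>\<^bsub>G\<^esub> a = x"
        using x a by (auto simp: t_def G.m_assoc)
      define U' where "U' = {z \<in> topspace X. t \<otimes>\<^bsub>G\<^esub> z \<in> U}"
      have "openin X U'"
        unfolding U'_def using G.continuous_left_mult[OF t] U by (rule openin_continuous_map_preimage)
      moreover have "a \<in> U'" using a ta that by (simp add: U'_def G.topspace_eq_carrier)
      ultimately have int: "f a \<in> Y interior_of (f ` U')" by (rule fa)
      let ?W = "(\<lambda>y. \<tau> t \<otimes>\<^bsub>H\<^esub> y) ` (Y interior_of (f ` U'))"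
      have "openin Y ?W"
        using \<tau>(1)[OF t] by (simp add: H.openin_left_translate)
      moreover have "f x \<in> ?W"
        using int \<tau>(2)[OF t a] ta by auto
      moreover have "?W \<subseteq> f ` U"
      proof -
        have "?W \<subseteq> (\<lambda>y. \<tau> t \<otimes>\<^bsub>H\<^esub> y) ` f ` U'"
          by (intro image_mono interior_of_subset)
        also have "\<dots> \<subseteq> f ` U"
        proof clarify
          fix z assume "z \<in> U'"
          then have "z \<in> carrier G" "t \<otimes>\<^bsub>G\<^esub> z \<in> U"
            by (auto simp: U'_def G.topspace_eq_carrier)
          then show "\<tau> t \<otimes>\<^bsub>H\<^esub> f z \<in> f ` U"
            using \<tau>(2)[OF t] by (metis imageI)
        qed
        finally show ?thesis .
      qed
      ultimately show ?thesis by blast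
    qed
    then show "openin Y (f ` U)"
      using openin_subopen[of Y "f ` U"] by blast
  qed
qed

end
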